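(* (Monodromy space of type $(0,-,3/2)$, Painlevé II, Flaschka--Newell form.) Let $\mathcal{R}=\mathrm{Spec}\,\mathbb{C}[a_1,a_2,a_3]$ and let $\mathcal{R}\to\mathcal{P}=\mathbb{C}$ be given by $(a_1,a_2,a_3)\mapsto s=\mathrm{tr}(top_\infty)$, where $$top_\infty=\begin{pmatrix}0&-1\\ 1&0\end{pmatrix}\begin{pmatrix}1&0\\ a_1&1\end{pmatrix}\begin{pmatrix}1&a_2\\ 0&1\end{pmatrix}\begin{pmatrix}1&0\\ a_3&1\end{pmatrix}.$$ Then $s=-a_1a_2a_3-a_1+a_2-a_3$, so $\mathcal{R}\to\mathcal{P}$ is the family of affine cubic surfaces $a_1a_2a_3+a_1-a_2+a_3+s=0$. The fibre over $s$ is singular only for $s=\pm2$: for $s=2$ it has exactly one singular point, $(a_1,a_2,a_3)=(-1,1,-1)$, and for $s=-2$ exactly one singular point, $(a_1,a_2,a_3)=(1,-1,1)$; both are of type $A_1$.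
   Context: A surface singularity is of type $A_n$ if it is locally analytically given by $x^2+y^2+z^{n+1}=0$. Origin of the data: rank-two differential modules on $\mathbb{P}^1$ (trivial determinant) with a regular singularity at $0$ and a ramified irregular singularity of Katz invariant $3/2$ at $\infty$; $top_\infty$ is the product of formal monodromy and three Stokes matrices, the monodromy at $0$ is $top_\infty^{-1}$ (which has the same trace), and the remaining base change acts trivially on the data. *)

theory Defs
  imports "HOL-Analysis.Analysis"
begin

definition holo_fun_on :: "(complex ^ 'n \<Rightarrow> complex) \<Rightarrow> (complex ^ 'n) set \<Rightarrow> bool" where
  "holo_fun_on f U \<longleftrightarrow>
     (\<forall>x\<in>U. \<exists>D. (f has_derivative D) (at x) \<and> (\<forall>c v. D (c *s v) = c * D v))"

definition holo_map_on :: "(complex ^ 'n \<Rightarrow> complex ^ 'm) \<Rightarrow> (complex ^ 'n) set \<Rightarrow> bool" where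
  "holo_map_on \<phi> U \<longleftrightarrow> (\<forall>i. holo_fun_on (\<lambda>x. \<phi> x $ i) U)"

definition biholomorphic_between ::
  "(complex ^ 'n) set \<Rightarrow> (complex ^ 'n) set \<Rightarrow> (complex ^ 'n \<Rightarrow> complex ^ 'n) \<Rightarrow> bool" where
  "biholomorphic_between U V \<phi> \<longleftrightarrow>
     open U \<and> open V \<and> bij_betw \<phi> U V \<and> holo_map_on \<phi> U \<and> holo_map_on (inv_into U \<phi>) V"

text \<open>
  A polynomial function \<open>f\<close> on \<open>\<complex>\<^sup>3\<close> stands for the affine surface with ideal \<open>(f)\<close>.
  It is singular at a closed point \<open>p\<close> if \<open>p\<close> lies on it and the Jacobian matrix of the
  generator \<open>f\<close> has rank less than the codimension, i.e. all partial derivatives vanish.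
\<close>

definition singular_points :: "(complex ^ 3 \<Rightarrow> complex) \<Rightarrow> (complex ^ 3) set" where
  "singular_points f =
     {p. f p = 0 \<and>
         (\<forall>i. ((\<lambda>t. f (\<chi> j. if j = i then t else p $ j)) has_field_derivative 0) (at (p $ i)))}"

text \<open>
  The surface with ideal \<open>(f)\<close> is locally analytically given at \<open>p\<close> by
  \<open>x\<^sup>2 + y\<^sup>2 + z\<^bsup>n+1\<^esup> = 0\<close>: there are analytic coordinates \<open>\<phi> = (x, y, z)\<close> of
  \<open>\<complex>\<^sup>3\<close> centred at \<open>p\<close> in which \<open>f\<close> and the model equation generate the same ideal,
  i.e. differ by a holomorphic unit \<open>u\<close> (so not only the zero sets correspond).
\<close>

definition singularity_type_A :: "nat \<Rightarrow> (complex ^ 3 \<Rightarrow> complex) \<Rightarrow> complex ^ 3 \<Rightarrow> bool" where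
  "singularity_type_A n f p \<longleftrightarrow>
     (\<exists>U V \<phi> u. biholomorphic_between U V \<phi> \<and> p \<in> U \<and> \<phi> p = 0 \<and>
        holo_fun_on u U \<and> (\<forall>a\<in>U. u a \<noteq> 0) \<and>
        (\<forall>a\<in>U. f a = u a * ((\<phi> a $ 1)\<^sup>2 + (\<phi> a $ 2)\<^sup>2 + (\<phi> a $ 3) ^ (n + 1))))"

definition mat2 :: "complex \<Rightarrow> complex \<Rightarrow> complex \<Rightarrow> complex \<Rightarrow> complex ^ 2 ^ 2" where
  "mat2 a b c d = vector [vector [a, b], vector [c, d]]"

text \<open>A point \<open>a\<close> of \<open>Spec \<complex>[a\<^sub>1, a\<^sub>2, a\<^sub>3]\<close> is given by its coordinate vector in \<open>\<complex>\<^sup>3\<close>.\<close>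

definition top_infty :: "complex ^ 3 \<Rightarrow> complex ^ 2 ^ 2" where
  "top_infty a =
     mat2 0 (- 1) 1 0 ** mat2 1 0 (a $ 1) 1 ** mat2 1 (a $ 2) 0 1 ** mat2 1 0 (a $ 3) 1"

definition to_parameter :: "complex ^ 3 \<Rightarrow> complex" where
  "to_parameter a = trace (top_infty a)"

definition fibre :: "complex \<Rightarrow> (complex ^ 3) set" where
  "fibre s = to_parameter -` {s}"

text \<open>The generator of the ideal of the scheme-theoretic fibre over \<open>s\<close>.\<close>

definition fibre_eqn :: "complex \<Rightarrow> complex ^ 3 \<Rightarrow> complex" where
  "fibre_eqn s a = to_parameter a - s"

end

(* With e = 1 or e = -1 and g = a1 a2 a3 + a1 - a2 + a3 + 2 e, completing the product gives
     a2 g = (a1 a2 + 1) (a2 a3 + 1) - (a2 - e)^2.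
   Where a2 is nonzero, the three polynomials a1 a2 + 1, a2 a3 + 1 and a2 - e are analytic
   coordinates with rational inverse, so the node is given by explicit global coordinates
   and the Morse lemma is not needed. *)

theory Submission
  imports Defs
begin

lemma holo_fun_on_const: "holo_fun_on (\<lambda>x. c) U"
  unfolding holo_fun_on_def by (intro ballI exI[of _ "\<lambda>h. 0"]) auto

lemma holo_fun_on_nth: "holo_fun_on (\<lambda>x. x $ i) U"
  unfolding holo_fun_on_def
  by (intro ballI exI[of _ "\<lambda>h. h $ i"])
     (auto intro: bounded_linear.has_derivative[OF bounded_linear_vec_nth])

lemma holo_fun_on_add:
  assumes "holo_fun_on f U" "holo_fun_on g U"
  shows "holo_fun_on (\<lambda>x. f x + g x) U"
  unfolding holo_fun_on_def
proof
  fix x assume "x \<in> U"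
  then obtain F G where "(f has_derivative F) (at x)" "\<And>c v. F (c *s v) = c * F v"
    and "(g has_derivative G) (at x)" "\<And>c v. G (c *s v) = c * G v"
    using assms unfolding holo_fun_on_def by meson
  then show "\<exists>D. ((\<lambda>x. f x + g x) has_derivative D) (at x) \<and> (\<forall>c v. D (c *s v) = c * D v)"
    by (intro exI[of _ "\<lambda>h. F h + G h"] conjI has_derivative_add) (auto simp: algebra_simps)
qed

lemma holo_fun_on_mult:
  assumes "holo_fun_on f U" "holo_fun_on g U"
  shows "holo_fun_on (\<lambda>x. f x * g x) U"
  unfolding holo_fun_on_def
proof
  fix x assume "x \<in> U"
  then obtain F G where "(f has_derivative F) (at x)" "\<And>c v. F (c *s v) = c * F v"
    and "(g has_derivative G) (at x)" "\<And>c v. G (c *s v) = c * G v"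
    using assms unfolding holo_fun_on_def by meson
  then show "\<exists>D. ((\<lambda>x. f x * g x) has_derivative D) (at x) \<and> (\<forall>c v. D (c *s v) = c * D v)"
    by (intro exI[of _ "\<lambda>h. f x * G h + F h * g x"] conjI has_derivative_mult)
       (auto simp: algebra_simps)
qed

lemma holo_fun_on_inverse:
  assumes "holo_fun_on f U" "\<And>x. x \<in> U \<Longrightarrow> f x \<noteq> 0"
  shows "holo_fun_on (\<lambda>x. inverse (f x)) U"
  unfolding holo_fun_on_def
proof
  fix x assume x: "x \<in> U"
  then obtain F where "(f has_derivative F) (at x)" "\<And>c v. F (c *s v) = c * F v"
    using assms unfolding holo_fun_on_def by meson
  then show "\<exists>D. ((\<lambda>x. inverse (f x)) has_derivative D) (at x) \<and> (\<forall>c v. D (c *s v) = c * D v)"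
    using assms(2)[OF x]
    by (intro exI[of _ "\<lambda>h. - (inverse (f x) * F h * inverse (f x))"] conjI
          Deriv.has_derivative_inverse) auto
qed

lemma holo_fun_on_diff:
  assumes "holo_fun_on f U" "holo_fun_on g U"
  shows "holo_fun_on (\<lambda>x. f x - g x) U"
  using holo_fun_on_add[OF assms(1) holo_fun_on_mult[OF holo_fun_on_const[of "- 1"] assms(2)]]
  by simp

lemma holo_fun_on_divide:
  assumes "holo_fun_on f U" "holo_fun_on g U" "\<And>x. x \<in> U \<Longrightarrow> g x \<noteq> 0"
  shows "holo_fun_on (\<lambda>x. f x / g x) U"
  using holo_fun_on_mult[OF assms(1) holo_fun_on_inverse[OF assms(2,3)]]
  by (simp add: divide_inverse)

lemmas holo_fun_on_intros =
  holo_fun_on_const holo_fun_on_nth holo_fun_on_add holo_fun_on_diff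
  holo_fun_on_mult holo_fun_on_divide

text \<open>Differentiability at a point depends only on the values nearby, and openness of
  \<open>U\<close> provides the neighbourhood. This serves for \<open>inv_into\<close>, which agrees
  with an explicit formula only on the target set.\<close>

lemma holo_fun_on_cong:
  assumes "open U" "holo_fun_on f U" "\<And>x. x \<in> U \<Longrightarrow> g x = f x"
  shows "holo_fun_on g U"
  unfolding holo_fun_on_def
proof
  fix x assume "x \<in> U"
  then show "\<exists>D. (g has_derivative D) (at x) \<and> (\<forall>c v. D (c *s v) = c * D v)"
    using assms has_derivative_transform_within_open[of f _ x UNIV U g]
    unfolding holo_fun_on_def by metis
qed

text \<open>An explicit two-sided inverse \<open>\<psi>\<close> coincides with
  \<open>inv_into U \<phi>\<close> on \<open>V\<close>, so holomorphy of the inverse can be read off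
  a formula, without the inverse function theorem.\<close>

lemma biholomorphic_betweenI:
  assumes "open U" "open V" "holo_map_on \<phi> U" "holo_map_on \<psi> V"
    and "\<And>a. a \<in> U \<Longrightarrow> \<phi> a \<in> V" "\<And>v. v \<in> V \<Longrightarrow> \<psi> v \<in> U"
    and "\<And>a. a \<in> U \<Longrightarrow> \<psi> (\<phi> a) = a" "\<And>v. v \<in> V \<Longrightarrow> \<phi> (\<psi> v) = v"
  shows "biholomorphic_between U V \<phi>"
proof -
  have bij: "bij_betw \<phi> U V"
    using assms(5-8) by (intro bij_betw_byWitness[where f' = \<psi>]) auto
  have "inv_into U \<phi> v = \<psi> v" if "v \<in> V" for v
    using bij that assms(6,8) by (metis bij_betw_inv_into_left)
  then have "holo_map_on (inv_into U \<phi>) V"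
    using assms(2,4) holo_fun_on_cong unfolding holo_map_on_def by (metis (lifting))
  then show ?thesis
    using assms bij by (simp add: biholomorphic_between_def)
qed

lemma to_parameter_eq:
  "to_parameter a = - (a $ 1) * (a $ 2) * (a $ 3) - a $ 1 + a $ 2 - a $ 3"
  unfolding to_parameter_def top_infty_def mat2_def trace_def matrix_matrix_mult_def
  by (simp add: sum_2 algebra_simps)

text \<open>The outer minus sign reappears later in the unit \<open>- 1 / a $ 2\<close>.\<close>

lemma fibre_eqn_eq:
  "fibre_eqn s a = - (a $ 1 * a $ 2 * a $ 3 + a $ 1 - a $ 2 + a $ 3 + s)"
  by (simp add: fibre_eqn_def to_parameter_eq algebra_simps)

lemma vec3_eq_iff: "a = b \<longleftrightarrow> a $ 1 = b $ 1 \<and> a $ 2 = b $ 2 \<and> a $ (3::3) = b $ 3"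
  by (simp add: vec_eq_iff forall_3)

text \<open>The cubic has degree one in each variable, so each partial derivative is a product of
  the other two coordinates plus or minus 1, and \<open>s\<close> drops out.\<close>

lemma partial_derivatives_zero_iff:
  "(\<forall>i. ((\<lambda>t. fibre_eqn s (\<chi> j. if j = i then t else p $ j)) has_field_derivative 0) (at (p $ i)))
   \<longleftrightarrow> p $ 2 * p $ 3 = - 1 \<and> p $ 1 * p $ 3 = 1 \<and> p $ 1 * p $ 2 = - 1"
proof -
  let ?f = "\<lambda>i t. fibre_eqn s (\<chi> j. if j = i then t else p $ j)"
  have d1: "(?f 1 has_field_derivative - (p $ 2 * p $ 3 + 1)) (at (p $ 1))"
    unfolding fibre_eqn_eq by (auto intro!: derivative_eq_intros)
  have d2: "(?f 2 has_field_derivative - (p $ 1 * p $ 3 - 1)) (at (p $ 2))"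
    unfolding fibre_eqn_eq by (auto intro!: derivative_eq_intros)
  have d3: "(?f 3 has_field_derivative - (p $ 1 * p $ 2 + 1)) (at (p $ 3))"
    unfolding fibre_eqn_eq by (auto intro!: derivative_eq_intros)
  \<comment> \<open>Uniqueness of the derivative turns each differentiability claim into a
    polynomial equation.\<close>
  have zero: "(g has_field_derivative 0) (at x) \<longleftrightarrow> D = 0"
    if "(g has_field_derivative D) (at x)" for g :: "complex \<Rightarrow> complex" and D x
    using that DERIV_unique by auto
  show ?thesis
    unfolding forall_3 zero[OF d1] zero[OF d2] zero[OF d3]
    by (simp only: neg_equal_0_iff_equal eq_neg_iff_add_eq_0 right_minus_eq)
qed

text \<open>The parameter \<open>e\<close> is the second coordinate of the singular point; the
  gradient equations force it to be a square root of 1, and the cubic then determines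
  \<open>s\<close>.\<close>

lemma singular_points_fibre_eqn:
  "p \<in> singular_points (fibre_eqn s) \<longleftrightarrow>
     (\<exists>e\<in>{1, - 1}. s = 2 * e \<and> p = vector [- e, e, - e])"
proof
  assume "p \<in> singular_points (fibre_eqn s)"
  then have f: "p $ 1 * p $ 2 * p $ 3 + p $ 1 - p $ 2 + p $ 3 + s = 0"
    and d: "p $ 2 * p $ 3 = - 1" "p $ 1 * p $ 3 = 1" "p $ 1 * p $ 2 = - 1"
    unfolding singular_points_def partial_derivatives_zero_iff by (auto simp: fibre_eqn_eq)
  \<comment> \<open>Adding the first two relations in \<open>d\<close> gives
    \<open>(p $ 1 + p $ 2) * p $ 3 = 0\<close> with \<open>p $ 3\<close> nonzero; the last two give
    \<open>p $ 3 = - p $ 2\<close> in the same way.\<close>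
  have p1: "p $ 1 = - p $ 2"
    using d by algebra
  have p3: "p $ 3 = - p $ 2"
    using d by algebra
  have "(p $ 2)\<^sup>2 = 1"
    using d(3) by (simp add: p1 power2_eq_square)
  then have "p $ 2 \<in> {1, - 1}"
    by (simp add: power2_eq_1_iff)
  \<comment> \<open>The cubic term equals \<open>- p $ 3\<close> and cancels the linear term
    \<open>p $ 3\<close>, leaving \<open>s = p $ 2 - p $ 1\<close>.\<close>
  moreover have "s = 2 * p $ 2"
    using f d by algebra
  ultimately show "\<exists>e\<in>{1, - 1}. s = 2 * e \<and> p = vector [- e, e, - e]"
    using p1 p3 by (intro bexI[of _ "p $ 2"]) (auto simp: vec3_eq_iff)
next
  assume "\<exists>e\<in>{1, - 1}. s = 2 * e \<and> p = vector [- e, e, - e]"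
  then show "p \<in> singular_points (fibre_eqn s)"
    unfolding singular_points_def partial_derivatives_zero_iff by (auto simp: fibre_eqn_eq)
qed

text \<open>Both nodes are handled at once through \<open>e\<close>. The chart covers the whole
  region where \<open>a $ 2\<close> is nonzero, which contains the node because its second
  coordinate is \<open>e\<close>.\<close>

lemma singularity_type_A1_fibre_eqn:
  assumes "e = 1 \<or> e = - 1"
  shows "singularity_type_A 1 (fibre_eqn (2 * e)) (vector [- e, e, - e])"
proof -
  define U :: "(complex ^ 3) set" where "U = {a. a $ 2 \<noteq> 0}"
  \<comment> \<open>\<open>e - \<i> * v $ 3\<close> is \<open>a $ 2\<close> recovered from the third
    coordinate \<open>\<i> * (a $ 2 - e)\<close>, so \<open>V\<close> is the image of
    \<open>U\<close>.\<close>
  define V :: "(complex ^ 3) set" where "V = {v. e - \<i> * v $ 3 \<noteq> 0}"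
  \<comment> \<open>The first two components diagonalise the product of \<open>a\<^sub>1 a\<^sub>2 + 1\<close> and \<open>a\<^sub>2 a\<^sub>3 + 1\<close>.\<close>
  define \<phi> :: "complex ^ 3 \<Rightarrow> complex ^ 3" where
    "\<phi> = (\<lambda>a. vector [(a $ 1 * a $ 2 + a $ 2 * a $ 3) / 2 + 1,
                   \<i> * (a $ 1 * a $ 2 - a $ 2 * a $ 3) / 2, \<i> * (a $ 2 - e)])"
  \<comment> \<open>The combinations \<open>v $ 1 - \<i> * v $ 2\<close> and
    \<open>v $ 1 + \<i> * v $ 2\<close> give back the factors \<open>a $ 1 * a $ 2 + 1\<close> and
    \<open>a $ 2 * a $ 3 + 1\<close>; subtracting 1 and dividing by \<open>a $ 2\<close> yields the
    outer coordinates.\<close>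
  define \<psi> :: "complex ^ 3 \<Rightarrow> complex ^ 3" where
    "\<psi> = (\<lambda>v. vector [(v $ 1 - \<i> * v $ 2 - 1) / (e - \<i> * v $ 3), e - \<i> * v $ 3,
                   (v $ 1 + \<i> * v $ 2 - 1) / (e - \<i> * v $ 3)])"
  have ii: "\<i> * (\<i> * x) = - x" for x
    by (simp flip: mult.assoc)
  have "biholomorphic_between U V \<phi>"
  proof (rule biholomorphic_betweenI[where \<psi> = \<psi>])
    show "open U"
      unfolding U_def by (intro open_Collect_neq continuous_intros)
    show "open V"
      unfolding V_def by (intro open_Collect_neq continuous_intros)
    show "holo_map_on \<phi> U"
      unfolding holo_map_on_def forall_3 \<phi>_def vector_3
      by (intro conjI holo_fun_on_intros) auto
    show "holo_map_on \<psi> V"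
      unfolding holo_map_on_def forall_3 \<psi>_def vector_3
      by (intro conjI holo_fun_on_intros) (auto simp: V_def)
    show "\<phi> a \<in> V" if "a \<in> U" for a
      using that by (simp add: U_def V_def \<phi>_def ii)
    show "\<psi> v \<in> U" if "v \<in> V" for v
      using that by (simp add: U_def V_def \<psi>_def)
    show "\<psi> (\<phi> a) = a" if "a \<in> U" for a
      using that by (simp add: U_def vec3_eq_iff \<phi>_def \<psi>_def ii field_simps)
    show "\<phi> (\<psi> v) = v" if "v \<in> V" for v
    proof -
      have \<psi>2: "\<psi> v $ 2 = e - \<i> * v $ 3"
        by (simp add: \<psi>_def)
      \<comment> \<open>\<open>\<phi>\<close> involves the outer coordinates only through their
        products with the middle one, where the denominators of \<open>\<psi>\<close>
        cancel.\<close>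
      have "\<psi> v $ 1 * \<psi> v $ 2 = v $ 1 - \<i> * v $ 2 - 1"
        "\<psi> v $ 2 * \<psi> v $ 3 = v $ 1 + \<i> * v $ 2 - 1"
        using that by (simp_all add: V_def \<psi>_def)
      then show ?thesis
        unfolding \<phi>_def by (simp add: vec3_eq_iff \<psi>2 ii diff_divide_distrib)
    qed
  qed
  moreover have "vector [- e, e, - e] \<in> U" "\<phi> (vector [- e, e, - e]) = 0"
    using assms by (auto simp: U_def \<phi>_def vec3_eq_iff)
  moreover have "holo_fun_on (\<lambda>a. - 1 / a $ 2) U"
    by (intro holo_fun_on_intros) (simp add: U_def)
  moreover have "fibre_eqn (2 * e) a =
      - 1 / a $ 2 * ((\<phi> a $ 1)\<^sup>2 + (\<phi> a $ 2)\<^sup>2 + (\<phi> a $ 3) ^ (1 + 1))" if "a \<in> U" for a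
  proof -
    have "(\<phi> a $ 1)\<^sup>2 + (\<phi> a $ 2)\<^sup>2 = (a $ 1 * a $ 2 + 1) * (a $ 2 * a $ 3 + 1)"
      by (simp add: \<phi>_def power_mult_distrib power_divide)
         (simp add: power2_eq_square field_simps)
    \<comment> \<open>The factor \<open>\<i>\<close> in the third coordinate turns the subtracted
      square into an added one.\<close>
    moreover have "(\<phi> a $ 3) ^ (1 + 1) = - ((a $ 2 - e)\<^sup>2)"
      by (simp add: \<phi>_def power_mult_distrib flip: power2_eq_square)
    \<comment> \<open>This cancels the constant term \<open>1 - e^2\<close>, which makes the
      expression below divisible by \<open>a $ 2\<close>.\<close>
    moreover have "e\<^sup>2 = 1"
      using assms by auto
    then have "(a $ 1 * a $ 2 + 1) * (a $ 2 * a $ 3 + 1) + - ((a $ 2 - e)\<^sup>2)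
        = - (a $ 2) * fibre_eqn (2 * e) a"
      unfolding fibre_eqn_eq by algebra
    ultimately show ?thesis
      using that by (simp add: U_def)
  qed
  ultimately show ?thesis
    unfolding singularity_type_A_def
    by (intro exI[of _ U] exI[of _ V] exI[of _ \<phi>] exI[of _ "\<lambda>a. - 1 / a $ 2"])
       (auto simp: U_def)
qed

theorem mainTheorem9:
  shows "(\<forall>a. to_parameter a = - (a $ 1) * (a $ 2) * (a $ 3) - a $ 1 + a $ 2 - a $ 3)
    \<and> (\<forall>s. fibre s = {a. a $ 1 * a $ 2 * a $ 3 + a $ 1 - a $ 2 + a $ 3 + s = 0})
    \<and> (\<forall>s a. fibre_eqn s a = - (a $ 1 * a $ 2 * a $ 3 + a $ 1 - a $ 2 + a $ 3 + s))
    \<and> (\<forall>s. singular_points (fibre_eqn s) \<noteq> {} \<longrightarrow> s = 2 \<or> s = - 2)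
    \<and> singular_points (fibre_eqn 2) = {vector [- 1, 1, - 1]}
    \<and> singular_points (fibre_eqn (- 2)) = {vector [1, - 1, 1]}
    \<and> singularity_type_A 1 (fibre_eqn 2) (vector [- 1, 1, - 1])
    \<and> singularity_type_A 1 (fibre_eqn (- 2)) (vector [1, - 1, 1])"
proof (intro conjI allI)
  show "fibre s = {a. a $ 1 * a $ 2 * a $ 3 + a $ 1 - a $ 2 + a $ 3 + s = 0}" for s
  proof -
    have "a \<in> fibre s \<longleftrightarrow> fibre_eqn s a = 0" for a
      by (simp add: fibre_def fibre_eqn_def)
    \<comment> \<open>Keeping the outer negation undistributed reduces vanishing of the generator to
      vanishing of the cubic.\<close>
    then show ?thesis
      by (auto simp: fibre_eqn_eq simp del: minus_add_distrib minus_diff_eq)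
  qed
  show "singular_points (fibre_eqn s) \<noteq> {} \<longrightarrow> s = 2 \<or> s = - 2" for s
    using singular_points_fibre_eqn[of _ s] by auto
  show "singular_points (fibre_eqn 2) = {vector [- 1, 1, - 1]}"
    by (auto simp: singular_points_fibre_eqn)
  show "singular_points (fibre_eqn (- 2)) = {vector [1, - 1, 1]}"
    by (auto simp: singular_points_fibre_eqn)
  show "singularity_type_A 1 (fibre_eqn 2) (vector [- 1, 1, - 1])"
    using singularity_type_A1_fibre_eqn[of 1] by simp
  show "singularity_type_A 1 (fibre_eqn (- 2)) (vector [1, - 1, 1])"
    using singularity_type_A1_fibre_eqn[of "- 1"] by simp
qed (rule to_parameter_eq fibre_eqn_eq)+

end
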